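(* Let $f\in\mathbb{Z}^{+}$ and let $\chi$ be a Dirichlet character of conductor $f$. Let $w_{1}\in\mathbb{C}$ with $\operatorname{Re}(w_{1})>0$, let $x\in\mathbb{C}$, and let $n\in\mathbb{Z}^{+}$. Then \[ L_{q}(1-n,x\mid \chi ;w_{1})=-\frac{\beta _{n,\chi }(x:q\mid w_{1})}{n}, \] where $L_{q}(s,x\mid \chi ;w_{1})=w_{1}\sum_{m=1}^{\infty }\frac{\chi (m)q^{w_{1}m}}{[x+w_{1}m]_q^{s}}$ and the numbers $\beta _{n,\chi }(x:q\mid w_{1})$ are defined by the generating function \[ -t\,w_{1}\sum_{m=1}^{\infty }\chi (m)q^{mw_{1}}e^{[mw_{1}+x]_q\,t}=\sum_{n=1}^{\infty }\frac{\beta _{n,\chi }(x:q\mid w_{1})}{n!}t^{n}. \]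
   Context: $q$ is a complex number with $0<|q|<1$ and a fixed choice of $\log q$; $q^{z}:=\exp(z\log q)$ for $z\in\mathbb{C}$, and $[z]_q=\frac{1-q^{z}}{1-q}$. Complex powers are taken with the principal branch of the logarithm. The Dirichlet character $\chi$ is extended to all integers as usual (periodic mod $f$, $\chi(m)=0$ if $\gcd(m,f)>1$). *)

theory Defs
  imports "HOL-Complex_Analysis.Complex_Analysis"
begin

definition dirichlet_character :: "nat \<Rightarrow> (int \<Rightarrow> complex) \<Rightarrow> bool" where
  "dirichlet_character f chi \<longleftrightarrow>
     (\<forall>a b. chi (a * b) = chi a * chi b) \<and>
     (\<forall>a. chi (a + int f) = chi a) \<and>
     (\<forall>a. chi a = 0 \<longleftrightarrow> \<not> coprime a (int f))"

definition induced_modulus :: "nat \<Rightarrow> (int \<Rightarrow> complex) \<Rightarrow> nat \<Rightarrow> bool" where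
  "induced_modulus f chi d \<longleftrightarrow>
     d dvd f \<and> (\<forall>a. coprime a (int f) \<longrightarrow> a mod int d = 1 mod int d \<longrightarrow> chi a = 1)"

definition dirichlet_conductor :: "nat \<Rightarrow> (int \<Rightarrow> complex) \<Rightarrow> nat" where
  "dirichlet_conductor f chi = (LEAST d. 0 < d \<and> induced_modulus f chi d)"

text \<open>Throughout, \<open>l\<close> is the chosen value of \<open>log q\<close>, i.e. \<open>exp l = q\<close>.\<close>

definition qpow :: "complex \<Rightarrow> complex \<Rightarrow> complex" where
  "qpow l z = exp (z * l)"

definition qnum :: "complex \<Rightarrow> complex \<Rightarrow> complex \<Rightarrow> complex" where
  "qnum q l z = (1 - qpow l z) / (1 - q)"

text \<open>The library's principal power has \<open>0 powr 0 = 0\<close>. Here \<open>0\<close> to the power \<open>0\<close> must be \<open>1\<close>: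
  the base may vanish for some \<open>m\<close>, and the identity at \<open>n = 1\<close> needs this convention.
  For \<open>n > 1\<close> the corresponding term is \<open>1 / 0 powr (1 - n) = 0\<close>, as it should be.\<close>

definition cpower :: "complex \<Rightarrow> complex \<Rightarrow> complex" where
  "cpower z s = (if s = 0 then 1 else z powr s)"

definition q_L :: "complex \<Rightarrow> complex \<Rightarrow> complex \<Rightarrow> complex \<Rightarrow> (int \<Rightarrow> complex) \<Rightarrow> complex \<Rightarrow> complex" where
  "q_L q l s x chi w =
     w * (\<Sum>m. chi (int (Suc m)) * qpow l (w * of_nat (Suc m)) /
               cpower (qnum q l (x + w * of_nat (Suc m))) s)"

text \<open>The generating function, read as an identity of convergent series for all \<open>t\<close> near \<open>0\<close>.
  It constrains \<open>\<beta> n\<close> for \<open>n \<ge> 1\<close> only.\<close>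

definition q_bernoulli_numbers ::
    "complex \<Rightarrow> complex \<Rightarrow> complex \<Rightarrow> (int \<Rightarrow> complex) \<Rightarrow> complex \<Rightarrow> (nat \<Rightarrow> complex) \<Rightarrow> bool" where
  "q_bernoulli_numbers q l x chi w \<beta> \<longleftrightarrow>
     (\<forall>\<^sub>F t in nhds 0. \<exists>S.
        (\<lambda>m. chi (int (Suc m)) * qpow l (of_nat (Suc m) * w) *
              exp (qnum q l (of_nat (Suc m) * w + x) * t)) sums S \<and>
        (\<lambda>n. \<beta> (Suc n) / fact (Suc n) * t ^ Suc n) sums (- t * w * S))"

text \<open>Such numbers exist whenever \<open>\<bar>q\<^sup>w\<bar> < 1\<close>, in particular for real \<open>log q\<close> and \<open>Re w > 0\<close>.\<close>

lemma norm_qpow_less_1: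
  assumes "exp l = q" "norm q < 1" "Im l = 0" "Re w > 0"
  shows "norm (qpow l w) < 1"
proof -
  have "exp (Re l) < 1"
    using assms(1,2) by (metis norm_exp_eq_Re)
  then have "Re w * Re l < 0"
    using assms(4) by (simp add: mult_pos_neg)
  then show ?thesis
    using assms(3) by (simp add: qpow_def)
qed

lemma dirichlet_character_bounded:
  assumes "f > 0" "dirichlet_character f chi"
  obtains K where "K > 0" "\<And>a. norm (chi a) \<le> K"
proof -
  have per: "chi (a + int f) = chi a" for a
    using assms(2) by (simp add: dirichlet_character_def)
  have shift: "chi (a + int k * int f) = chi a" for a k
  proof (induction k)
    case (Suc k)
    then show ?case
      using per[of "a + int k * int f"] by (simp add: algebra_simps)
  qed simp
  have red: "chi a = chi (a mod int f)" for a
  proof (cases "a \<ge> 0")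
    case True
    then have "a div int f \<ge> 0"
      using assms(1) by (simp add: pos_imp_zdiv_nonneg_iff)
    then show ?thesis
      using shift[of "a mod int f" "nat (a div int f)"] by (simp add: mult.commute)
  next
    case False
    then have "a div int f \<le> 0"
      using assms(1) by (meson div_neg_pos_less0 less_imp_le not_le of_nat_0_less_iff)
    moreover have "a - (a div int f) * int f = a mod int f"
      by (simp add: minus_div_mult_eq_mod)
    ultimately show ?thesis
      using shift[of a "nat (- (a div int f))"] by simp
  qed
  have "finite (chi ` {0..<int f})"
    by simp
  then obtain K where K: "K > 0" "\<forall>z\<in>chi ` {0..<int f}. norm z \<le> K"
    using finite_imp_bounded bounded_pos by metis
  have "norm (chi a) \<le> K" for a
  proof -
    have "a mod int f \<in> {0..<int f}"
      using assms(1) by simp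
    then show ?thesis
      using K(2) red[of a] by (metis imageI)
  qed
  with K(1) show ?thesis
    using that by blast
qed

lemma q_bernoulli_numbers_exist:
  assumes "f > 0" "dirichlet_character f chi" "norm q < 1" "norm (qpow l w) < 1"
  shows "\<exists>\<beta>. q_bernoulli_numbers q l x chi w \<beta>"
proof -
  define a where "a = (\<lambda>m. chi (int (Suc m)) * qpow l (of_nat (Suc m) * w))"
  define c where "c = (\<lambda>m. qnum q l (of_nat (Suc m) * w + x))"
  define r where "r = norm (qpow l w)"
  obtain K where K: "K > 0" "\<And>m. norm (chi m) \<le> K"
    using dirichlet_character_bounded[OF assms(1,2)] by blast
  have r: "0 \<le> r" "r < 1"
    using assms(4) by (auto simp: r_def)
  have qp: "qpow l (of_nat k * w) = qpow l w ^ k" for k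
    by (simp add: qpow_def exp_of_nat_mult mult.assoc)
  have na: "norm (a m) \<le> K * r ^ Suc m" for m
  proof -
    have "norm (a m) = norm (chi (int (Suc m))) * r ^ Suc m"
      unfolding a_def norm_mult qp by (simp only: norm_power r_def)
    also have "\<dots> \<le> K * r ^ Suc m"
      by (rule mult_right_mono[OF K(2)]) (simp add: r)
    finally show ?thesis .
  qed
  define C where "C = (1 + norm (qpow l x)) / norm (1 - q)"
  have nc: "norm (c m) \<le> C" for m
  proof -
    have eq: "qpow l (of_nat (Suc m) * w + x) = qpow l w ^ Suc m * qpow l x"
      by (subst qp[symmetric]) (simp add: qpow_def exp_add distrib_right)
    have "norm (qpow l w ^ Suc m) \<le> 1"
      using r unfolding norm_power r_def by (intro power_le_one) auto
    then have "norm (qpow l (of_nat (Suc m) * w + x)) \<le> norm (qpow l x)"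
      unfolding eq norm_mult by (intro mult_left_le_one_le) auto
    then have "norm (1 - qpow l (of_nat (Suc m) * w + x)) \<le> 1 + norm (qpow l x)"
      using norm_triangle_ineq4[of 1 "qpow l (of_nat (Suc m) * w + x)"] by simp
    then show ?thesis
      unfolding c_def qnum_def C_def norm_divide by (intro divide_right_mono) auto
  qed
  define S where "S = (\<lambda>t. \<Sum>m. a m * exp (c m * t))"
  have bound: "norm (a m * exp (c m * t)) \<le> K * r ^ Suc m * exp C" if "t \<in> ball 0 1" for m t
  proof -
    have "Re (c m * t) \<le> norm (c m * t)"
      by (rule complex_Re_le_cmod)
    also have "\<dots> \<le> C * 1"
      unfolding norm_mult using that nc[of m] by (intro mult_mono) (auto intro: order_trans[OF norm_ge_zero nc])
    finally have "norm (exp (c m * t)) \<le> exp C"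
      by simp
    then show ?thesis
      unfolding norm_mult using na[of m] K r by (intro mult_mono) auto
  qed
  have sumb: "summable (\<lambda>m. K * r ^ Suc m * exp C)"
    using r by (intro summable_mult2 summable_mult) (subst summable_Suc_iff, rule summable_geometric, simp)
  have ulim: "uniform_limit (ball 0 1) (\<lambda>N t. \<Sum>m<N. a m * exp (c m * t)) S sequentially"
    unfolding S_def by (rule Weierstrass_m_test[OF bound sumb])
  have sums: "(\<lambda>m. a m * exp (c m * t)) sums S t" if "t \<in> ball 0 1" for t
    using tendsto_uniform_limitI[OF ulim that] by (simp add: sums_def)
  have hol: "S holomorphic_on ball 0 1"
  proof (rule holomorphic_uniform_sequence[where f = "\<lambda>N t. \<Sum>m<N. a m * exp (c m * t)"])
    show "\<exists>d>0. cball t d \<subseteq> ball 0 1 \<and>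
        uniform_limit (cball t d) (\<lambda>N t. \<Sum>m<N. a m * exp (c m * t)) S sequentially"
      if t: "t \<in> ball 0 1" for t :: complex
    proof -
      obtain d where d: "d > 0" "cball t d \<subseteq> ball 0 1"
        using t open_contains_cball_eq[OF open_ball] by metis
      then show ?thesis
        using uniform_limit_on_subset[OF ulim d(2)] by (intro exI[of _ d] conjI)
    qed
  qed (auto intro!: holomorphic_intros)
  define F where "F = (\<lambda>t. - t * w * S t)"
  have "F holomorphic_on ball 0 1"
    unfolding F_def using hol by (intro holomorphic_intros)
  then have ser: "(\<lambda>n. (deriv ^^ n) F 0 / fact n * t ^ n) sums F t" if "t \<in> ball 0 1" for t
    using holomorphic_power_series[OF _ that] by simp
  have ser': "(\<lambda>n. (deriv ^^ Suc n) F 0 / fact (Suc n) * t ^ Suc n) sums F t"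
    if "t \<in> ball 0 1" for t
    using ser[OF that] by (subst sums_Suc_iff) (simp add: F_def)
  have "q_bernoulli_numbers q l x chi w (\<lambda>n. (deriv ^^ n) F 0)"
    unfolding q_bernoulli_numbers_def
  proof (rule eventually_mono)
    show "\<forall>\<^sub>F t in nhds 0. (t::complex) \<in> ball 0 1"
      by (rule eventually_nhds_in_open) auto
  next
    fix t :: complex
    assume "t \<in> ball 0 1"
    then show "\<exists>S. (\<lambda>m. chi (int (Suc m)) * qpow l (of_nat (Suc m) * w) *
              exp (qnum q l (of_nat (Suc m) * w + x) * t)) sums S \<and>
        (\<lambda>n. (deriv ^^ Suc n) F 0 / fact (Suc n) * t ^ Suc n) sums (- t * w * S)"
      using sums[of t] ser'[of t] unfolding a_def c_def F_def by (intro exI[of _ "S t"] conjI)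
  qed
  then show ?thesis
    by blast
qed

end

theory Submission
  imports Defs
begin

text \<open>
  At \<open>t = 0\<close> the generating function is \<open>\<Sum>m. \<chi> m * q ^ (m w)\<close>. Its convergence forces
  \<open>\<bar>q ^ w\<bar> < 1\<close>, because \<open>\<chi> m = 1\<close> along \<open>m = 1 + k f\<close>; this is not implied by \<open>Re w > 0\<close> when
  \<open>log q\<close> is not real. The series of exponentials then converges uniformly near \<open>0\<close>, so
  its Taylor coefficients may be computed termwise, and comparing coefficients gives
  \<open>\<beta> n = - n w (\<Sum>m. \<chi> m * q ^ (m w) * [x + m w] ^ (n - 1))\<close>.
\<close>

lemma qpow_of_nat_mult: "qpow l (of_nat k * w) = qpow l w ^ k"
  by (simp add: qpow_def exp_of_nat_mult mult.assoc)

lemma qpow_add: "qpow l (y + z) = qpow l y * qpow l z"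
  by (simp add: qpow_def exp_add distrib_right)

text \<open>For \<open>n = 1\<close> this is the convention \<open>cpower y 0 = 1\<close>. For
  \<open>n > 1\<close> and \<open>y = 0\<close> both sides vanish: \<open>0 powr\<close> a negative
  integer is \<open>0\<close>, division by \<open>0\<close> gives \<open>0\<close>, and the exponent
  on the right is positive.\<close>

lemma divide_cpower_one_minus_of_nat:
  assumes "n > 0"
  shows "z / cpower y (1 - of_nat n) = z * y ^ (n - 1)"
proof (cases "n = 1")
  case False
  then obtain k where k: "n = Suc k" "k > 0"
    using assms by (cases n) auto
  then have "cpower y (1 - of_nat n) = inverse (y ^ k)"
    using powr_minus[of y "of_nat k"] by (simp add: cpower_def powr_nat')
  then show ?thesis
    using k by (simp add: divide_inverse)
qed (simp add: cpower_def)

lemma dirichlet_character_add_mult: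
  assumes "dirichlet_character f chi"
  shows "chi (a + int k * int f) = chi a"
proof (induction k)
  case (Suc k)
  have "chi (a + int k * int f + int f) = chi (a + int k * int f)"
    using assms by (simp add: dirichlet_character_def)
  with Suc show ?case
    by (simp add: algebra_simps)
qed simp

lemma norm_less_1_if_summable_dirichlet_character:
  assumes "f > 0" "dirichlet_character f chi"
    and "summable (\<lambda>m. chi (int (Suc m)) * Q ^ Suc m)"
  shows "norm Q < 1"
proof (rule ccontr)
  assume "\<not> norm Q < 1"
  then have Q: "1 \<le> norm Q ^ k" for k
    by (simp add: one_le_power)
  have "chi 1 \<noteq> 0"
    using assms(2) by (simp add: dirichlet_character_def)
  have "(\<lambda>m. chi (int (Suc m)) * Q ^ Suc m) \<longlonglongrightarrow> 0"
    using assms(3) by (rule summable_LIMSEQ_zero)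
  \<comment> \<open>The index shift by \<open>Suc\<close> turns \<open>k * f\<close> into
    \<open>m = k * f + 1\<close>, where periodicity gives the nonzero value
    \<open>chi 1\<close>.\<close>
  moreover have "strict_mono (\<lambda>k. k * f)"
    using assms(1) by (simp add: strict_mono_def)
  ultimately have "(\<lambda>k. chi (int (Suc (k * f))) * Q ^ Suc (k * f)) \<longlonglongrightarrow> 0"
    by (auto dest: LIMSEQ_subseq_LIMSEQ simp: o_def)
  moreover have "chi (int (Suc (k * f))) = chi 1" for k
    using dirichlet_character_add_mult[OF assms(2), of 1 k] by simp
  ultimately have "(\<lambda>k. chi 1 * Q ^ Suc (k * f)) \<longlonglongrightarrow> 0"
    by simp
  then have "(\<lambda>k. norm (chi 1 * Q ^ Suc (k * f))) \<longlonglongrightarrow> 0"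
    by (rule tendsto_norm_zero)
  moreover have "norm (chi 1) \<le> norm (chi 1 * Q ^ Suc (k * f))" for k
    using mult_left_mono[OF Q[of "Suc (k * f)"], of "norm (chi 1)"]
    by (simp only: norm_mult norm_power norm_ge_zero mult_1_right)
  ultimately have "norm (chi 1) \<le> 0"
    by (intro LIMSEQ_le_const) auto
  with \<open>chi 1 \<noteq> 0\<close> show False
    by simp
qed

text \<open>The bound on \<open>c m\<close> keeps all exponentials below \<open>exp C\<close> on the
  unit disc. The M-test then gives uniform convergence there, so each derivative at \<open>0\<close>
  is the limit of the derivatives of the partial sums.\<close>

lemma has_fps_expansion_suminf_exp:
  fixes a c :: "nat \<Rightarrow> complex"
  assumes sa: "summable (\<lambda>m. norm (a m))" and c: "\<And>m. norm (c m) \<le> C"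
  shows "(\<lambda>t. \<Sum>m. a m * exp (c m * t)) has_fps_expansion
           Abs_fps (\<lambda>k. (\<Sum>m. a m * c m ^ k) / fact k)"
proof -
  define P where "P = (\<lambda>N t. \<Sum>m<N. a m * exp (c m * t))"
  define S where "S = (\<lambda>t. \<Sum>m. a m * exp (c m * t))"
  have bound: "norm (a m * exp (c m * t)) \<le> norm (a m) * exp C" if "t \<in> ball 0 1" for m t
  proof -
    have "norm (c m * t) \<le> C * 1"
      unfolding norm_mult using that c[of m]
      by (intro mult_mono) (auto intro: order_trans[OF norm_ge_zero c])
    then have "norm (exp (c m * t)) \<le> exp C"
      by (metis complex_Re_le_cmod exp_le_cancel_iff mult.right_neutral norm_exp_eq_Re order_trans)
    then show ?thesis
      unfolding norm_mult by (intro mult_left_mono) auto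
  qed
  have ulim: "uniform_limit (ball 0 1) P S sequentially"
    unfolding P_def S_def by (rule Weierstrass_m_test[OF bound summable_mult2[OF sa]])
  have P_holo: "P N holomorphic_on A" for N A
    unfolding P_def by (intro holomorphic_intros)
  have "S holomorphic_on ball 0 1"
  proof (rule holomorphic_uniform_sequence)
    fix t :: complex
    assume "t \<in> ball 0 1"
    then obtain d where "d > 0" "cball t d \<subseteq> ball 0 1"
      using open_contains_cball_eq[OF open_ball] by metis
    then show "\<exists>d>0. cball t d \<subseteq> ball 0 1 \<and> uniform_limit (cball t d) P S sequentially"
      using uniform_limit_on_subset[OF ulim] by blast
  qed (use P_holo in auto)
  then have S_fps: "S has_fps_expansion fps_expansion S 0"
    by (intro has_fps_expansion_fps_expansion[where A = "ball 0 1"]) auto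
  have "(deriv ^^ k) S 0 = (\<Sum>m. a m * c m ^ k)" for k
  proof -
    have "(deriv ^^ k) (P N) 0 = (\<Sum>m<N. a m * c m ^ k)" for N
    proof -
      \<comment> \<open>The derivative of a partial sum is read off as \<open>fact k\<close> times a
        coefficient of a finite sum of \<open>fps_exp\<close> series.\<close>
      have "P N has_fps_expansion (\<Sum>m<N. fps_const (a m) * fps_exp (c m))"
        unfolding P_def by (intro fps_expansion_intros)
      from fps_nth_fps_expansion[OF this, of k] show ?thesis
        by (simp add: fps_sum_nth flip: sum_divide_distrib)
    qed
    moreover have "(\<lambda>N. (deriv ^^ k) (P N) 0) \<longlonglongrightarrow> (deriv ^^ k) S 0"
      by (rule higher_deriv_complex_uniform_limit[OF ulim]) (auto simp: P_holo)
    ultimately show ?thesis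
      by (simp add: sums_unique sums_def)
  qed
  then have "fps_expansion S 0 = Abs_fps (\<lambda>k. (\<Sum>m. a m * c m ^ k) / fact k)"
    by (simp add: fps_expansion_def)
  with S_fps show ?thesis
    by (simp add: S_def)
qed

theorem theorem2:
  fixes q l x w\<^sub>1 :: complex and f n :: nat and chi :: "int \<Rightarrow> complex" and \<beta> :: "nat \<Rightarrow> complex"
  assumes "0 < norm q" and "norm q < 1" and "exp l = q"
    and "f > 0" and "dirichlet_character f chi" and "dirichlet_conductor f chi = f"
    and "Re w\<^sub>1 > 0"
    and "n > 0"
    and "q_bernoulli_numbers q l x chi w\<^sub>1 \<beta>"
  shows "q_L q l (1 - of_nat n) x chi w\<^sub>1 = - \<beta> n / of_nat n"
proof -
  define a where "a = (\<lambda>m. chi (int (Suc m)) * qpow l (of_nat (Suc m) * w\<^sub>1))"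
  define c where "c = (\<lambda>m. qnum q l (of_nat (Suc m) * w\<^sub>1 + x))"
  define S where "S = (\<lambda>t. \<Sum>m. a m * exp (c m * t))"
  have gen: "\<forall>\<^sub>F t in nhds 0. \<exists>S. (\<lambda>m. a m * exp (c m * t)) sums S \<and>
      (\<lambda>n. \<beta> (Suc n) / fact (Suc n) * t ^ Suc n) sums (- t * w\<^sub>1 * S)"
    using assms(9) unfolding q_bernoulli_numbers_def a_def c_def .
  have a_eq: "a m = chi (int (Suc m)) * qpow l w\<^sub>1 ^ Suc m" for m
    unfolding a_def qpow_of_nat_mult ..

  \<comment> \<open>What holds eventually in \<open>nhds 0\<close> holds at \<open>0\<close> itself,
    where every factor \<open>exp (c m * t)\<close> is \<open>1\<close>.\<close>
  have "summable a"
    using eventually_nhds_x_imp_x[OF gen] by (auto simp: sums_iff)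
  then have Q: "norm (qpow l w\<^sub>1) < 1"
    by (intro norm_less_1_if_summable_dirichlet_character[OF assms(4,5)]) (simp add: a_eq[symmetric] del: power_Suc of_nat_Suc)

  obtain K where K: "\<And>m. norm (chi m) \<le> K"
    using dirichlet_character_bounded[OF assms(4,5)] by blast
  have "summable (\<lambda>m. norm (a m))"
  proof (rule summable_comparison_test')
    show "summable (\<lambda>m. K * norm (qpow l w\<^sub>1) ^ Suc m)"
      using Q by (intro summable_mult) (subst summable_Suc_iff, simp add: summable_geometric)
    show "norm (norm (a m)) \<le> K * norm (qpow l w\<^sub>1) ^ Suc m" if "m \<ge> 0" for m
      unfolding real_norm_def abs_norm_cancel
      unfolding a_eq norm_mult norm_power by (intro mult_right_mono K) simp
  qed
  \<comment> \<open>The bound is uniform in \<open>m\<close> since the factor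
    \<open>qpow l w\<^sub>1 ^ Suc m\<close> has modulus at most \<open>1\<close>.\<close>
  moreover have "norm (c m) \<le> (1 + norm (qpow l x)) / norm (1 - q)" for m
  proof -
    have "norm (qpow l w\<^sub>1) ^ Suc m \<le> 1"
      using Q by (intro power_le_one) auto
    then have "norm (qpow l (of_nat (Suc m) * w\<^sub>1 + x)) \<le> norm (qpow l x)"
      unfolding qpow_add qpow_of_nat_mult norm_mult norm_power
      by (intro mult_left_le_one_le) auto
    then have "norm (1 - qpow l (of_nat (Suc m) * w\<^sub>1 + x)) \<le> 1 + norm (qpow l x)"
      using norm_triangle_ineq4[of 1 "qpow l (of_nat (Suc m) * w\<^sub>1 + x)"] by simp
    then show ?thesis
      unfolding c_def qnum_def norm_divide by (intro divide_right_mono) auto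
  qed
  ultimately have "S has_fps_expansion Abs_fps (\<lambda>k. (\<Sum>m. a m * c m ^ k) / fact k)"
    unfolding S_def by (rule has_fps_expansion_suminf_exp)
  then have "(\<lambda>t. - w\<^sub>1 * (t * S t)) has_fps_expansion
      fps_const (- w\<^sub>1) * (fps_X * Abs_fps (\<lambda>k. (\<Sum>m. a m * c m ^ k) / fact k))"
    by (intro fps_expansion_intros)
  \<comment> \<open>The generating function expands the same function a second time. Its series
    starts at exponent \<open>1\<close>, so the constant coefficient is \<open>0\<close>, whatever
    \<open>\<beta> 0\<close> is.\<close>
  moreover have "(\<lambda>t. - w\<^sub>1 * (t * S t)) has_fps_expansion
      Abs_fps (\<lambda>k. if k = 0 then 0 else \<beta> k / fact k)"
  proof (rule has_fps_expansionI, rule eventually_mono[OF gen])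
    fix t
    assume "\<exists>S. (\<lambda>m. a m * exp (c m * t)) sums S \<and>
      (\<lambda>n. \<beta> (Suc n) / fact (Suc n) * t ^ Suc n) sums (- t * w\<^sub>1 * S)"
    \<comment> \<open>The value of a convergent series is unique, so the sum asserted to exist is
      \<open>S t\<close>.\<close>
    then have "(\<lambda>n. \<beta> (Suc n) / fact (Suc n) * t ^ Suc n) sums (- w\<^sub>1 * (t * S t))"
      unfolding S_def by (auto simp: sums_iff mult_ac)
    then show "(\<lambda>n. fps_nth (Abs_fps (\<lambda>k. if k = 0 then 0 else \<beta> k / fact k)) n * t ^ n) sums
        (- w\<^sub>1 * (t * S t))"
      using sums_Suc_iff[of "\<lambda>k. (if k = 0 then 0 else \<beta> k / fact k) * t ^ k"] by simp
  qed
  ultimately have "Abs_fps (\<lambda>k. if k = 0 then 0 else \<beta> k / fact k) =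
      fps_const (- w\<^sub>1) * (fps_X * Abs_fps (\<lambda>k. (\<Sum>m. a m * c m ^ k) / fact k))"
    by (rule fps_expansion_unique_complex[rotated])
  \<comment> \<open>The factor \<open>fps_X\<close> shifts coefficients by one: the right side
    contributes index \<open>n - 1\<close>, and \<open>fact n / fact (n - 1)\<close> leaves the
    factor \<open>n\<close>.\<close>
  from arg_cong[OF this, of "\<lambda>F. fps_nth F n"]
  have "\<beta> n / fact n = - w\<^sub>1 * ((\<Sum>m. a m * c m ^ (n - 1)) / fact (n - 1))"
    using assms(8) by simp
  moreover have "fact n = (of_nat n * fact (n - 1) :: complex)"
    using assms(8) by (rule fact_reduce)
  ultimately have "\<beta> n / of_nat n = - w\<^sub>1 * (\<Sum>m. a m * c m ^ (n - 1))"
    by (simp add: field_simps)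
  \<comment> \<open>The summands agree one by one; \<open>q_L\<close> only has the factors of
    \<open>w\<^sub>1 * m\<close> and the addends of \<open>x + w\<^sub>1 * m\<close> in the other
    order.\<close>
  moreover have "q_L q l (1 - of_nat n) x chi w\<^sub>1 = w\<^sub>1 * (\<Sum>m. a m * c m ^ (n - 1))"
    unfolding q_L_def divide_cpower_one_minus_of_nat[OF assms(8)] a_def c_def
    by (simp only: mult.commute[of w\<^sub>1] add.commute[of x])
  ultimately show ?thesis
    by simp
qed

end
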